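(* Let $G=(V,E)$ be a finite simple directed graph and let $V_\ell\subseteq V$ be a set of leaders. Then $$\delta(G,V_\ell)\le \delta(G,\mathrm{dset}(G,V_\ell)),\qquad \zeta(G,V_\ell)\le \delta(G,\mathrm{dset}(G,V_\ell)),\qquad \delta(G,\mathrm{dset}(G,V_\ell))\le\gamma(G,V_\ell).$$
   Context: Graphs. $G=(V,E)$ is a finite simple directed graph (no self-loops, no multiple edges) with node set $V=\{v_1,\dots,v_n\}$; $e_{ij}$ denotes an edge from $v_i$ to $v_j$. A node $v_j$ is an in-neighbor of $v_i$ if there is an edge from $v_j$ to $v_i$. The distance $d(u,v)\in\{0,1,2,\dots\}\cup\{\infty\}$ is the number of edges on a shortest directed path from $u$ to $v$, with $d(v,v)=0$ and $d(u,v)=\infty$ if there is no path from $u$ to $v$. Distance-based quantity $\delta(G,V')$. For any set $V'=\{\ell_1,\dots,\ell_m\}\subseteq V$ taken as leader set, the distance-to-leaders (DL) vector of a node $v\in V$ is $(d(v,\ell_1),\dots,d(v,\ell_m))$. A finite sequence $(\mathcal D_1,\dots,\mathcal D_k)$ of DL vectors of nodes of $G$ is pseudo-monotonically increasing (PMI) if for every $i$ there exists $\pi(i)\in\{1,\dots,m\}$ such that $[\mathcal D_i]_{\pi(i)}<[\mathcal D_j]_{\pi(i)}$ for all $j>i$ (here every finite number is $<\infty$, and $\infty<\infty$ is false; for the last vector the condition is vacuous). $\delta(G,V')$ is the length of a longest PMI sequence all of whose members are DL vectors (with respect to $V'$) of nodes of $G$ having at least one finite entry. Zero-forcing quantity $\zeta(G,V_\ell)$.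 Color the nodes of $V_\ell$ black and all other nodes white. Zero forcing rule: if a black node $v$ has exactly one white in-neighbor $u$, then $u$ is recolored black. The rule is applied repeatedly until no further color change is possible; the resulting set of black nodes is uniquely determined and is called the derived set $\mathrm{dset}(G,V_\ell)$. Define $\zeta(G,V_\ell)=|\mathrm{dset}(G,V_\ell)|$. Dimension of the strong structurally controllable subspace $\gamma(G,V_\ell)$. For a weight function $w:E\to\mathbb R^+$ (strictly positive weights), the weighted adjacency matrix $A_w\in\mathbb R^{n\times n}$ has $[A_w]_{ij}=w(e_{ij})$ if $e_{ij}\in E$ and $0$ otherwise; the degree matrix $\Delta$ is diagonal with $[\Delta]_{ii}=\sum_{k=1}^n [A_w]_{ik}$; the weighted Laplacian is $L_w=\Delta-A_w$. For $V_\ell=\{\ell_1,\dots,\ell_m\}$, the input matrix $B\in\mathbb R^{n\times m}$ has $[B]_{ij}=1$ if $v_i=\ell_j$ and $0$ otherwise. The controllability matrix (of the system $\dot x=-L_wx+Bu$) is $$\Gamma(L_w,V_\ell)=\begin{bmatrix} B & (-L_w)B & (-L_w)^2B & \cdots & (-L_w)^{n-1}B\end{bmatrix},$$ and $$\gamma(G,V_\ell)=\min_{w:E\to\mathbb R^+}\operatorname{rank}\Gamma(L_w,V_\ell).$$ *)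

theory Defs
  imports
    "Graph_Theory.Pair_Digraph"
    "Jordan_Normal_Form.DL_Rank"
    "HOL-Library.Extended_Nat"
begin

text \<open>A finite simple digraph is a \<open>pair_digraph\<close>: arcs are ordered pairs of distinct nodes,
  and the arc \<open>(u, v)\<close> goes from \<open>u\<close> to \<open>v\<close>.\<close>

section \<open>Distances to leaders\<close>

text \<open>The infimum over the empty set in \<^typ>\<open>enat\<close> is \<open>\<infinity>\<close>, so the distance to an unreachable
  node is \<open>\<infinity>\<close>.\<close>

definition graph_dist :: "'a pair_pre_digraph \<Rightarrow> 'a \<Rightarrow> 'a \<Rightarrow> enat" where
  "graph_dist G u v = (INF p \<in> {p. pre_digraph.apath (with_proj G) u p v}. enat (length p))"

text \<open>Distance-to-leaders vectors are families indexed by the leader set itself, which avoids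
  choosing a numbering of the leaders; the value off the leader set is the dummy
  \<^const>\<open>undefined\<close>.\<close>

definition dl_vector :: "'a pair_pre_digraph \<Rightarrow> 'a set \<Rightarrow> 'a \<Rightarrow> 'a \<Rightarrow> enat" where
  "dl_vector G V' v = (\<lambda>l. if l \<in> V' then graph_dist G v l else undefined)"

definition admissible_dl_vectors :: "'a pair_pre_digraph \<Rightarrow> 'a set \<Rightarrow> ('a \<Rightarrow> enat) set" where
  "admissible_dl_vectors G V' =
     {D. (\<exists>v \<in> pverts G. D = dl_vector G V' v) \<and> (\<exists>l \<in> V'. D l \<noteq> \<infinity>)}"

definition pmi :: "'a set \<Rightarrow> ('a \<Rightarrow> enat) list \<Rightarrow> bool" where
  "pmi V' Ds \<longleftrightarrow>
     (\<forall>i < length Ds. \<exists>l \<in> V'. \<forall>j. i < j \<and> j < length Ds \<longrightarrow> (Ds ! i) l < (Ds ! j) l)"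

text \<open>The empty sequence counts as pseudo-monotonically increasing, so the value is \<open>0\<close> when there
  are no leaders. The set of lengths is finite: the members of such a sequence are
  pairwise distinct.\<close>

definition delta :: "'a pair_pre_digraph \<Rightarrow> 'a set \<Rightarrow> nat" where
  "delta G V' = Max {length Ds | Ds. set Ds \<subseteq> admissible_dl_vectors G V' \<and> pmi V' Ds}"

section \<open>Zero forcing\<close>

definition white_in_neighbors :: "'a pair_pre_digraph \<Rightarrow> 'a set \<Rightarrow> 'a \<Rightarrow> 'a set" where
  "white_in_neighbors G S v = {u \<in> pverts G - S. (u, v) \<in> parcs G}"

definition forcing_step :: "'a pair_pre_digraph \<Rightarrow> 'a set \<Rightarrow> 'a set \<Rightarrow> bool" where
  "forcing_step G S S' \<longleftrightarrow> (\<exists>v \<in> S. \<exists>u. white_in_neighbors G S v = {u} \<and> S' = insert u S)"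

definition is_derived_set :: "'a pair_pre_digraph \<Rightarrow> 'a set \<Rightarrow> 'a set \<Rightarrow> bool" where
  "is_derived_set G Vl S \<longleftrightarrow> (forcing_step G)\<^sup>*\<^sup>* Vl S \<and> (\<nexists>S'. forcing_step G S S')"

definition dset :: "'a pair_pre_digraph \<Rightarrow> 'a set \<Rightarrow> 'a set" where
  "dset G Vl = (THE S. is_derived_set G Vl S)"

lemma ex1_derived_set:
  assumes "finite (pverts G)"
  shows "\<exists>!S. is_derived_set G Vl S"
proof -
  have sub: "S \<subseteq> T" if "(forcing_step G)\<^sup>*\<^sup>* Vl S" "Vl \<subseteq> T" "\<nexists>S'. forcing_step G T S'" for S T
    using that(1)
  proof (induction rule: rtranclp_induct)
    case base
    show ?case by (rule that(2))
  next
    case (step S S')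
    then obtain v u where v: "v \<in> S" and w: "white_in_neighbors G S v = {u}"
      and S': "S' = insert u S"
      unfolding forcing_step_def by blast
    have "u \<in> T"
    proof (rule ccontr)
      assume "u \<notin> T"
      with w step.IH have "white_in_neighbors G T v = {u}"
        unfolding white_in_neighbors_def by blast
      with v step.IH that(3) show False
        unfolding forcing_step_def by blast
    qed
    with S' step.IH show ?case by blast
  qed
  have sup: "Vl \<subseteq> S" if "(forcing_step G)\<^sup>*\<^sup>* Vl S" for S
    using that by (induction rule: rtranclp_induct) (auto simp: forcing_step_def)
  have ex: "\<exists>T. is_derived_set G S T" for S
  proof (induction "card (pverts G - S)" arbitrary: S rule: less_induct)
    case less
    show ?case
    proof (cases "\<exists>S'. forcing_step G S S'")
      case True
      then obtain S' where S': "forcing_step G S S'" by blast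
      then have "pverts G - S' \<subset> pverts G - S"
        unfolding forcing_step_def white_in_neighbors_def by blast
      then have "card (pverts G - S') < card (pverts G - S)"
        using assms by (intro psubset_card_mono) auto
      from less[OF this] S' show ?thesis
        unfolding is_derived_set_def by (meson converse_rtranclp_into_rtranclp)
    next
      case False
      then show ?thesis unfolding is_derived_set_def by blast
    qed
  qed
  have "S = T" if "is_derived_set G Vl S" "is_derived_set G Vl T" for S T
    using that sub sup unfolding is_derived_set_def by (intro subset_antisym) blast+
  with ex show ?thesis by blast
qed

definition zeta :: "'a pair_pre_digraph \<Rightarrow> 'a set \<Rightarrow> nat" where
  "zeta G Vl = card (dset G Vl)"

section \<open>Dimension of the strong structurally controllable subspace\<close>

text \<open>The list \<open>vs\<close> is a numbering of all nodes and \<open>ls\<close> a numbering of the leaders (both without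
  repetition); indices start at \<open>0\<close>.\<close>

definition adjacency_mat ::
  "'a pair_pre_digraph \<Rightarrow> 'a list \<Rightarrow> ('a \<times> 'a \<Rightarrow> real) \<Rightarrow> real mat" where
  "adjacency_mat G vs w = mat (length vs) (length vs)
     (\<lambda>(i, j). if (vs ! i, vs ! j) \<in> parcs G then w (vs ! i, vs ! j) else 0)"

definition degree_mat ::
  "'a pair_pre_digraph \<Rightarrow> 'a list \<Rightarrow> ('a \<times> 'a \<Rightarrow> real) \<Rightarrow> real mat" where
  "degree_mat G vs w = mat (length vs) (length vs)
     (\<lambda>(i, j). if i = j then \<Sum>k<length vs. adjacency_mat G vs w $$ (i, k) else 0)"

definition laplacian_mat ::
  "'a pair_pre_digraph \<Rightarrow> 'a list \<Rightarrow> ('a \<times> 'a \<Rightarrow> real) \<Rightarrow> real mat" where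
  "laplacian_mat G vs w = degree_mat G vs w - adjacency_mat G vs w"

definition input_mat :: "'a list \<Rightarrow> 'a list \<Rightarrow> real mat" where
  "input_mat vs ls = mat (length vs) (length ls) (\<lambda>(i, j). if vs ! i = ls ! j then 1 else 0)"

text \<open>The columns are those of \<open>B\<close>, \<open>(-L)B\<close>, \<open>\<dots>\<close>, \<open>(-L)\<^sup>n\<^sup>-\<^sup>1B\<close>, in this order.\<close>

definition controllability_mat :: "nat \<Rightarrow> real mat \<Rightarrow> real mat \<Rightarrow> real mat" where
  "controllability_mat n L B = mat_of_cols n (concat (map (\<lambda>k. cols ((- L) ^\<^sub>m k * B)) [0..<n]))"

text \<open>The minimum over all positive weightings exists, since ranks are natural numbers; values of
  \<open>w\<close> off the arc set are irrelevant.\<close>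

definition gamma :: "'a pair_pre_digraph \<Rightarrow> 'a list \<Rightarrow> 'a list \<Rightarrow> nat" where
  "gamma G vs ls = (LEAST r. \<exists>w :: 'a \<times> 'a \<Rightarrow> real. (\<forall>e \<in> parcs G. 0 < w e) \<and>
     r = vec_space.rank (length vs)
           (controllability_mat (length vs) (laplacian_mat G vs w) (input_mat vs ls)))"

end

theory Submission
  imports Defs
begin

text \<open>Let \<open>R\<close> be the column space of the controllability matrix. A Krylov sequence in an
  \<open>n\<close>-dimensional space stabilises after \<open>n\<close> steps, so \<open>R\<close> is invariant under \<open>-L\<close>. If \<open>R\<close> contains the
  unit vectors of all black nodes and the black node \<open>v\<close> has the single white in-neighbor \<open>u\<close>,
  then column \<open>v\<close> of \<open>-L\<close> lies in \<open>R\<close> and is, up to black unit vectors, a positive multiple of the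
  unit vector of \<open>u\<close>. Hence \<open>R\<close> contains the unit vectors of the whole derived set and all their
  images under powers of \<open>-L\<close>. The entry of \<open>(-L)\<^sup>k e\<^sub>l\<close> at \<open>v\<close> vanishes for \<open>k < d(v, l)\<close> and is positive
  for \<open>k = d(v, l)\<close>, so a pseudo-monotonically increasing sequence gives a triangular, hence
  independent, family in \<open>R\<close>. The other two inequalities hold because \<open>\<delta>\<close> is monotone in the leader
  set, and because the leaders themselves, in any order, form such a sequence.\<close>

section \<open>Krylov subspaces and dimension\<close>

context vec_space
begin

text \<open>Independence survives appending a vector outside the span of the previous ones; the list
  form also yields distinctness, so that length counts dimension.\<close>

lemma chain_lin_indpt:
  assumes "set xs \<subseteq> carrier_vec n"
    and "\<And>i. i < length xs \<Longrightarrow> xs ! i \<notin> span (set (take i xs))"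
  shows "distinct xs \<and> lin_indpt (set xs)"
  using assms
proof (induction xs rule: rev_induct)
  case Nil
  show ?case by (simp add: lin_dep_def)
next
  case (snoc x xs)
  have "xs ! i \<notin> span (set (take i xs))" if "i < length xs" for i
    using snoc.prems(2)[of i] that by (simp add: nth_append)
  with snoc have IH: "distinct xs" "lin_indpt (set xs)" by auto
  have C: "set xs \<subseteq> carrier_vec n" "x \<in> carrier_vec n" using snoc.prems(1) by auto
  have x: "x \<notin> span (set xs)" using snoc.prems(2)[of "length xs"] by simp
  then have "x \<notin> set xs" using C in_own_span[of "set xs"] by auto
  with IH x C lin_dep_iff_in_span[of "set xs" x] show ?case by simp
qed

text \<open>Linear dependence means the same in the ambient space and in \<open>span_vs W\<close>,
  whose dimension bounds independent sets. This is the source of the lower bound on the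
  rank.\<close>

lemma chain_length_le_dim_span:
  assumes W: "W \<subseteq> carrier_vec n" "finite W" and xs: "set xs \<subseteq> span W"
    and chain: "\<And>i. i < length xs \<Longrightarrow> xs ! i \<notin> span (set (take i xs))"
  shows "length xs \<le> vectorspace.dim class_ring (span_vs W)"
proof -
  have "set xs \<subseteq> carrier_vec n" using W xs span_is_subset2[of W] by auto
  then have *: "distinct xs" "lin_indpt (set xs)" using chain_lin_indpt chain by blast+
  have sub: "submodule class_ring (span W) V" using W span_is_submodule by simp
  have vs: "vectorspace class_ring (span_vs W)"
    using W span_is_subspace subspace_is_vs by simp
  have "module.lin_dep class_ring (span_vs W) (set xs) = lin_dep (set xs)"
    by (rule span_li_not_depend(2)[OF xs sub])
  then have "card (set xs) \<le> vectorspace.dim class_ring (span_vs W)"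
    using vectorspace.li_le_dim(2)[OF vs fin_dim_span[of W], of "set xs"] W xs * by simp
  with * show ?thesis by (simp add: distinct_card)
qed

text \<open>Linear combinations preserve a zero at \<open>p\<close>; this later certifies that a
  vector with a nonzero entry at \<open>p\<close> lies outside a span.\<close>

lemma span_entry_zero:
  assumes "S \<subseteq> carrier_vec n" and "\<And>s. s \<in> S \<Longrightarrow> s $ p = 0" and "p < n" and "v \<in> span S"
  shows "v $ p = 0"
proof -
  obtain a A where "v = lincomb a A" "A \<subseteq> S" using in_spanE[OF assms(4)] by blast
  with assms show ?thesis
    by (subst \<open>v = lincomb a A\<close>, subst lincomb_index) (auto intro!: sum.neutral)
qed

lemma zero_in_span: "W \<subseteq> carrier_vec n \<Longrightarrow> 0\<^sub>v n \<in> span W"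
  using submodule.zero_closed[OF span_is_submodule[of W]] by simp

text \<open>The preimage of \<open>span T\<close> under \<open>A\<close> is a submodule, so
  containing \<open>S\<close> it contains \<open>span S\<close>. Invariance is thereby checked on
  generators.\<close>

lemma mult_mat_vec_span:
  assumes A: "A \<in> carrier_mat n n" and S: "S \<subseteq> carrier_vec n" and T: "T \<subseteq> carrier_vec n"
    and gen: "\<And>s. s \<in> S \<Longrightarrow> A *\<^sub>v s \<in> span T" and v: "v \<in> span S"
  shows "A *\<^sub>v v \<in> span T"
proof -
  let ?N = "{v \<in> carrier_vec n. A *\<^sub>v v \<in> span T}"
  have "submodule class_ring ?N V"
  proof (unfold_locales, goal_cases)
    case 1
    show ?case by auto
  next
    case (2 v w)
    then show ?case
      using A span_add1[OF _ , of T "A *\<^sub>v v" "A *\<^sub>v w"] T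
      by (auto simp: mult_add_distrib_mat_vec)
  next
    case 3
    have "A *\<^sub>v 0\<^sub>v n = 0\<^sub>v n" using A by (intro eq_vecI) auto
    then show ?case using zero_in_span[OF T] by simp
  next
    case (4 c v)
    then show ?case using A smult_in_span[OF T] by (auto simp: mult_mat_vec)
  qed
  moreover have "S \<subseteq> ?N" using S gen by auto
  ultimately have "span S \<subseteq> ?N" by (intro span_is_subset)
  with v show ?thesis by auto
qed

lemma supported_in_span:
  assumes W: "W \<subseteq> carrier_vec n" and x: "x \<in> carrier_vec n"
    and supp: "\<And>p. p < n \<Longrightarrow> x $ p \<noteq> 0 \<Longrightarrow> unit_vec n p \<in> span W"
  shows "x \<in> span W"
proof -
  \<comment> \<open>The vector is rebuilt one coordinate at a time; a zero entry only adds the zero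
    vector.\<close>
  have "vec n (\<lambda>p. if p < m then x $ p else 0) \<in> span W" if "m \<le> n" for m
    using that
  proof (induction m)
    case 0
    have "vec n (\<lambda>p. if p < 0 then x $ p else 0) = 0\<^sub>v n" by auto
    then show ?case using zero_in_span[OF W] by simp
  next
    case (Suc m)
    have eq: "vec n (\<lambda>p. if p < Suc m then x $ p else 0)
        = vec n (\<lambda>p. if p < m then x $ p else 0) + x $ m \<cdot>\<^sub>v unit_vec n m"
      using Suc.prems by (auto simp: less_Suc_eq)
    have "x $ m \<cdot>\<^sub>v unit_vec n m \<in> span W"
    proof (cases "x $ m = 0")
      case True
      then have "x $ m \<cdot>\<^sub>v unit_vec n m = 0\<^sub>v n" by auto
      then show ?thesis using zero_in_span[OF W] by simp
    next
      case False
      then show ?thesis using supp Suc.prems smult_in_span[OF W] by simp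
    qed
    then show ?case unfolding eq using Suc span_add1[of W] W by simp
  qed
  from this[of n] have "vec n (\<lambda>p. if p < n then x $ p else 0) \<in> span W" by simp
  also have "vec n (\<lambda>p. if p < n then x $ p else 0) = x" using x by auto
  finally show ?thesis .
qed

section \<open>Krylov sequences\<close>

lemma krylov_carrier:
  assumes "A \<in> carrier_mat n n" "b \<in> carrier_vec n"
  shows "((*\<^sub>v) A ^^ k) b \<in> carrier_vec n"
  using assms by (induction k) auto

text \<open>Among the first \<open>Suc n\<close> iterates one depends on its predecessors, by
  dimension. The span of these predecessors is then invariant under \<open>A\<close> and absorbs all
  further iterates.\<close>

lemma krylov_in_span:
  assumes A: "A \<in> carrier_mat n n" and b: "b \<in> carrier_vec n"
  shows "((*\<^sub>v) A ^^ k) b \<in> span ((\<lambda>j. ((*\<^sub>v) A ^^ j) b) ` {..<n})"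
proof -
  let ?x = "\<lambda>j. ((*\<^sub>v) A ^^ j) b"
  let ?K = "\<lambda>m. ?x ` {..<m}"
  have C: "?K m \<subseteq> carrier_vec n" for m using krylov_carrier[OF A b] by blast
  have "\<exists>m\<le>n. ?x m \<in> span (?K m)"
  proof (rule ccontr)
    assume neg: "\<not> ?thesis"
    let ?xs = "map ?x [0..<Suc n]"
    have "?xs ! i \<notin> span (set (take i ?xs))" if "i < length ?xs" for i
    proof -
      have "set (take i ?xs) = ?K i" using that by (auto simp: take_map simp del: upt_Suc)
      with neg that show ?thesis by (simp del: upt_Suc)
    qed
    then have "distinct ?xs \<and> lin_indpt (set ?xs)"
      using krylov_carrier[OF A b] by (intro chain_lin_indpt) (auto simp del: upt_Suc)
    moreover have "set ?xs \<subseteq> carrier_vec n" using krylov_carrier[OF A b] by auto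
    ultimately have "length ?xs \<le> dim"
      using li_le_dim(2)[of "set ?xs"] distinct_card[of ?xs] by simp
    then show False using dim_is_n by simp
  qed
  then obtain m where m: "m \<le> n" "?x m \<in> span (?K m)" by blast
  \<comment> \<open>The image of a generator is the next generator or \<open>?x m\<close>, which
    lies in the span by the choice of \<open>m\<close>.\<close>
  have inv: "A *\<^sub>v v \<in> span (?K m)" if "v \<in> span (?K m)" for v
  proof (rule mult_mat_vec_span[OF A C C _ that])
    fix s assume "s \<in> ?K m"
    then obtain j where j: "j < m" "s = ?x j" by auto
    have "?x (Suc j) \<in> span (?K m)"
    proof (cases "Suc j = m")
      case True
      with m show ?thesis by simp
    next
      case False
      with j show ?thesis using in_own_span[of "?K m"] C by (auto simp del: funpow.simps)
    qed
    with j show "A *\<^sub>v s \<in> span (?K m)" by simp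
  qed
  have "?x k \<in> span (?K m)"
  proof (induction k)
    case 0
    show ?case
    proof (cases "m = 0")
      case True
      with m show ?thesis by simp
    next
      case False
      then have "?x 0 \<in> ?K m" by blast
      then show ?thesis using in_own_span[of "?K m"] C by auto
    qed
  next
    case (Suc k)
    then show ?case using inv by simp
  qed
  moreover have "span (?K m) \<subseteq> span (?K n)" using m by (intro span_is_monotone) auto
  ultimately show ?thesis by blast
qed

end

section \<open>Columns of the controllability matrix\<close>

lemma pow_mat_mult_vec:
  assumes "A \<in> carrier_mat n n" "b \<in> carrier_vec n"
  shows "(A ^\<^sub>m k) *\<^sub>v b = ((*\<^sub>v) A ^^ k) b"
  using assms(2)
proof (induction k arbitrary: b)
  case 0
  with assms(1) show ?case by auto
next
  case (Suc k)
  \<comment> \<open>A matrix power gains its new factor on the right, function iteration on the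
    left; hence \<open>b\<close> is generalised and \<open>funpow_swap1\<close> closes the
    gap.\<close>
  have "(A ^\<^sub>m Suc k) *\<^sub>v b = (A ^\<^sub>m k) *\<^sub>v (A *\<^sub>v b)"
    using assms(1) Suc.prems by (simp add: assoc_mult_mat_vec[of _ n n])
  also have "\<dots> = ((*\<^sub>v) A ^^ k) (A *\<^sub>v b)" using assms(1) Suc by auto
  finally show ?case by (simp add: funpow_swap1)
qed

text \<open>Column \<open>j\<close> of a product \<open>P * B\<close> is \<open>P\<close> applied to
  \<open>col B j\<close>; this turns the block matrix into Krylov sequences started at the columns
  of \<open>B\<close>.\<close>

lemma set_cols_controllability_mat:
  assumes L: "L \<in> carrier_mat n n" and B: "B \<in> carrier_mat n m"
  shows "set (cols (controllability_mat n L B))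
    = {((*\<^sub>v) (- L) ^^ k) (col B j) | k j. k < n \<and> j < m}"
proof -
  let ?cs = "concat (map (\<lambda>k. cols ((- L) ^\<^sub>m k * B)) [0..<n])"
  have L': "- L \<in> carrier_mat n n" using L by simp
  have P: "(- L) ^\<^sub>m k \<in> carrier_mat n n" for k using L' by simp
  have "set (cols ((- L) ^\<^sub>m k * B)) = {((*\<^sub>v) (- L) ^^ k) (col B j) | j. j < m}" for k
  proof -
    have "col ((- L) ^\<^sub>m k * B) j = ((*\<^sub>v) (- L) ^^ k) (col B j)" if "j < m" for j
      using that B pow_mat_mult_vec[OF L', of "col B j" k] by (simp add: col_mult2[OF P B])
    then show ?thesis using B by (auto simp: cols_def)
  qed
  then have S: "set ?cs = {((*\<^sub>v) (- L) ^^ k) (col B j) | k j. k < n \<and> j < m}" by (auto; blast)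
  \<comment> \<open>\<open>mat_of_cols\<close> gives back its list of columns unchanged only if all
    of them have dimension \<open>n\<close>.\<close>
  have "set (cols ((- L) ^\<^sub>m k * B)) \<subseteq> carrier_vec n" for k
    using cols_dim[of "(- L) ^\<^sub>m k * B"] mult_carrier_mat[OF P B] by (metis carrier_matD(1))
  then have "set ?cs \<subseteq> carrier_vec n" by auto
  then show ?thesis unfolding controllability_mat_def using cols_mat_of_cols S by metis
qed

section \<open>Distances in digraphs\<close>

text \<open>As \<open>enat\<close> is well-ordered, the infimum of a nonempty set is attained, and a
  finite value excludes the empty set.\<close>

lemma graph_dist_witness:
  assumes "graph_dist G u v = enat k"
  obtains p where "pre_digraph.apath (with_proj G) u p v" "length p = k"
proof -
  let ?S = "(\<lambda>p. enat (length p)) ` {p. pre_digraph.apath (with_proj G) u p v}"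
  have "?S \<noteq> {}"
  proof
    assume "?S = {}"
    then have "graph_dist G u v = \<infinity>" unfolding graph_dist_def by (simp add: top_enat_def)
    with assms show False by simp
  qed
  then have "Inf ?S \<in> ?S" by (rule wellorder_InfI[OF ex_in_conv[THEN iffD2, THEN someI_ex]])
  with assms that show ?thesis unfolding graph_dist_def by auto
qed

lemma graph_dist_le:
  assumes "pre_digraph.apath (with_proj G) u p v"
  shows "graph_dist G u v \<le> enat (length p)"
  unfolding graph_dist_def using assms by (intro INF_lower) auto

lemma graph_dist_eq_0_iff:
  assumes "pair_wf_digraph G" "u \<in> pverts G"
  shows "graph_dist G u v = 0 \<longleftrightarrow> u = v"
proof -
  interpret pair_wf_digraph G by fact
  show ?thesis
  proof
    assume "graph_dist G u v = 0"
    then obtain p where "apath u p v" "length p = 0"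
      using graph_dist_witness[of G u v 0] by (auto simp: zero_enat_def)
    then show "u = v" by (simp add: apath_Nil_iff)
  next
    assume "u = v"
    with assms(2) have "apath u [] v" by (simp add: apath_Nil_iff)
    then show "graph_dist G u v = 0" using graph_dist_le[of G u "[]" v] by (simp add: zero_enat_def[symmetric])
  qed
qed

text \<open>Distances range over paths without repeated nodes. Prepending the arc keeps a path of
  this kind unless \<open>u\<close> already lies on it; in that case its tail from \<open>u\<close>
  on is short enough.\<close>

lemma graph_dist_arc_le:
  assumes "pair_wf_digraph G" and arc: "(u, w) \<in> parcs G"
  shows "graph_dist G u v \<le> eSuc (graph_dist G w v)"
proof (cases "graph_dist G w v")
  case (enat k)
  interpret pair_wf_digraph G by fact
  obtain p where p: "apath w p v" "length p = k" using graph_dist_witness[OF enat] .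
  obtain q where "apath u q v" "length q \<le> Suc k"
  proof (cases "u \<in> set (awalk_verts w p)")
    case False
    with p arc have "apath u ((u, w) # p) v" by (simp add: apath_Cons_iff)
    with p show ?thesis by (intro that) auto
  next
    case True
    then obtain q r where qr: "p = q @ r" "awalk w q u" using awalk_decomp[OF awalkI_apath[OF p(1)]] by blast
    with p(1) have "apath u r v" by (auto simp: apath_append_iff)
    with p qr show ?thesis by (intro that) auto
  qed
  then show ?thesis using graph_dist_le[of G u q v] enat by (simp add: eSuc_enat order.trans)
qed simp

text \<open>The first arc of a shortest path is removed; a still shorter remainder would contradict
  \<open>graph_dist_arc_le\<close>.\<close>

lemma graph_dist_Suc_arc:
  assumes "pair_wf_digraph G" and d: "graph_dist G u v = enat (Suc k)"
  obtains w where "(u, w) \<in> parcs G" "graph_dist G w v = enat k"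
proof -
  interpret pair_wf_digraph G by fact
  obtain p where p: "apath u p v" "length p = Suc k" using graph_dist_witness[OF d] .
  then obtain e q where eq: "p = e # q" by (cases p) auto
  then obtain w where e: "e = (u, w)" "(u, w) \<in> parcs G" "apath w q v"
    using p by (cases e) (auto simp: apath_Cons_iff)
  have "graph_dist G w v \<le> enat k" using graph_dist_le[OF e(3)] p eq by simp
  moreover have "enat (Suc k) \<le> eSuc (graph_dist G w v)"
    using graph_dist_arc_le[OF assms(1) e(2), of v] d by simp
  ultimately have "graph_dist G w v = enat k"
    by (cases "graph_dist G w v") (auto simp: eSuc_enat)
  with e that show ?thesis by blast
qed

section \<open>Pseudo-monotonically increasing sequences\<close>

lemma pmi_distinct: "pmi V' Ds \<Longrightarrow> distinct Ds"
  unfolding pmi_def distinct_conv_nth by (metis linorder_neqE_nat order.irrefl)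

text \<open>This makes the \<open>Max\<close> in \<open>delta\<close> meaningful: distinctness
  bounds lengths by the number of admissible vectors, and the empty list supplies a member.\<close>

lemma pmi_lengths:
  assumes "finite (pverts G)"
  shows "finite {length Ds | Ds. set Ds \<subseteq> admissible_dl_vectors G V' \<and> pmi V' Ds}" (is "finite ?S")
    and "{length Ds | Ds. set Ds \<subseteq> admissible_dl_vectors G V' \<and> pmi V' Ds} \<noteq> {}"
proof -
  have fin: "finite (admissible_dl_vectors G V')"
    by (rule finite_subset[of _ "dl_vector G V' ` pverts G"])
      (use assms in \<open>auto simp: admissible_dl_vectors_def\<close>)
  have "?S \<subseteq> {..card (admissible_dl_vectors G V')}"
    using fin by (auto simp: distinct_card[OF pmi_distinct, symmetric] intro: card_mono)
  then show "finite ?S" by (rule finite_subset) simp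
  have "pmi V' []" by (simp add: pmi_def)
  then show "?S \<noteq> {}" by (auto intro!: exI[of _ "[]"])
qed

lemma length_le_delta:
  assumes "finite (pverts G)" "set Ds \<subseteq> admissible_dl_vectors G V'" "pmi V' Ds"
  shows "length Ds \<le> delta G V'"
  unfolding delta_def using pmi_lengths(1)[OF assms(1)] assms by (intro Max_ge) auto

lemma delta_witness:
  assumes "finite (pverts G)"
  obtains Ds where "set Ds \<subseteq> admissible_dl_vectors G V'" "pmi V' Ds" "length Ds = delta G V'"
  using Max_in[OF pmi_lengths[OF assms, of V']] unfolding delta_def[symmetric] by auto

text \<open>Vectors of the same node for \<open>U\<close> and \<open>V'\<close> agree on
  \<open>U\<close>, so every coordinate witnessing the PMI property, and every finite entry,
  survives the enlargement.\<close>

lemma delta_mono: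
  assumes fin: "finite (pverts G)" and "U \<subseteq> V'"
  shows "delta G U \<le> delta G V'"
proof -
  obtain Ds where Ds: "set Ds \<subseteq> admissible_dl_vectors G U" "pmi U Ds" "length Ds = delta G U"
    using delta_witness[OF fin] .
  \<comment> \<open>Sequences consist of vectors rather than nodes, so a node realising each vector
    has to be chosen.\<close>
  define f where "f D = (SOME v. v \<in> pverts G \<and> D = dl_vector G U v)" for D
  have f: "f D \<in> pverts G" "D = dl_vector G U (f D)" if "D \<in> set Ds" for D
    using that Ds(1) someI_ex[of "\<lambda>v. v \<in> pverts G \<and> D = dl_vector G U v"]
    unfolding f_def admissible_dl_vectors_def by auto
  let ?Es = "map (\<lambda>D. dl_vector G V' (f D)) Ds"
  have eq: "dl_vector G V' (f D) l = D l" if "D \<in> set Ds" "l \<in> U" for D l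
  proof -
    have "dl_vector G V' (f D) l = dl_vector G U (f D) l"
      using assms(2) that(2) by (auto simp: dl_vector_def)
    with f(2)[OF that(1)] show ?thesis by simp
  qed
  have "dl_vector G V' (f D) \<in> admissible_dl_vectors G V'" if D: "D \<in> set Ds" for D
  proof -
    obtain l where "l \<in> U" "D l \<noteq> \<infinity>" using Ds(1) D unfolding admissible_dl_vectors_def by blast
    then have "l \<in> V'" "dl_vector G V' (f D) l \<noteq> \<infinity>" using eq[OF D] assms(2) by auto
    with f(1)[OF D] show ?thesis unfolding admissible_dl_vectors_def by blast
  qed
  then have "set ?Es \<subseteq> admissible_dl_vectors G V'" by auto
  moreover have "pmi V' ?Es"
    unfolding pmi_def
  proof (intro allI impI)
    fix i assume i: "i < length ?Es"
    then obtain l where l: "l \<in> U" "\<forall>j. i < j \<and> j < length Ds \<longrightarrow> (Ds ! i) l < (Ds ! j) l"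
      using Ds(2) unfolding pmi_def by auto
    then show "\<exists>l\<in>V'. \<forall>j. i < j \<and> j < length ?Es \<longrightarrow> (?Es ! i) l < (?Es ! j) l"
      using i assms(2) eq by (intro bexI[of _ l]) auto
  qed
  ultimately have "length ?Es \<le> delta G V'" by (rule length_le_delta[OF fin])
  with Ds(3) show ?thesis by simp
qed

text \<open>Among the leaders, only \<open>u\<close> has entry 0 at coordinate \<open>u\<close>.
  Listing their vectors in any order therefore gives a PMI sequence, with this 0 also serving as the
  finite entry.\<close>

lemma card_leaders_le_delta:
  assumes "pair_wf_digraph G" and fin: "finite (pverts G)" and "V' \<subseteq> pverts G"
  shows "card V' \<le> delta G V'"
proof -
  obtain us where us: "set us = V'" "distinct us"
    using finite_distinct_list finite_subset[OF assms(3) fin] by blast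
  let ?Ds = "map (dl_vector G V') us"
  have d: "graph_dist G u l = 0 \<longleftrightarrow> u = l" if "u \<in> V'" for u l
    using graph_dist_eq_0_iff[OF assms(1)] that assms(3) by blast
  have "set ?Ds \<subseteq> admissible_dl_vectors G V'"
  proof
    fix D assume "D \<in> set ?Ds"
    then obtain u where u: "u \<in> V'" "D = dl_vector G V' u" using us by auto
    then have "D u = 0" using d by (simp add: dl_vector_def)
    with u assms(3) show "D \<in> admissible_dl_vectors G V'"
      unfolding admissible_dl_vectors_def by (auto simp: zero_enat_def intro!: bexI[of _ u])
  qed
  moreover have "pmi V' ?Ds"
    unfolding pmi_def
  proof (intro allI impI)
    fix i assume i: "i < length ?Ds"
    then have ui: "us ! i \<in> V'" using us by auto
    have "(?Ds ! i) (us ! i) < (?Ds ! j) (us ! i)" if j: "i < j" "j < length ?Ds" for j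
    proof -
      have "us ! j \<in> V'" "us ! j \<noteq> us ! i" using us i j by (auto simp: nth_eq_iff_index_eq)
      then have "graph_dist G (us ! i) (us ! i) = 0" "graph_dist G (us ! j) (us ! i) \<noteq> 0"
        using d ui by auto
      with ui i j show ?thesis by (simp add: dl_vector_def zero_less_iff_neq_zero)
    qed
    with ui show "\<exists>l\<in>V'. \<forall>j. i < j \<and> j < length ?Ds \<longrightarrow> (?Ds ! i) l < (?Ds ! j) l" by blast
  qed
  ultimately have "length ?Ds \<le> delta G V'" by (rule length_le_delta[OF fin])
  with us show ?thesis using distinct_card[of us] by simp
qed

section \<open>Zero forcing\<close>

lemma forcing_bounds:
  assumes "(forcing_step G)\<^sup>*\<^sup>* Vl S" "Vl \<subseteq> pverts G"
  shows "Vl \<subseteq> S" "S \<subseteq> pverts G"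
  using assms
  by (induction rule: rtranclp_induct) (auto simp: forcing_step_def white_in_neighbors_def)

lemma derived_set_bounds:
  assumes "finite (pverts G)" "Vl \<subseteq> pverts G"
  shows "(forcing_step G)\<^sup>*\<^sup>* Vl (dset G Vl)" "Vl \<subseteq> dset G Vl" "dset G Vl \<subseteq> pverts G"
proof -
  have "is_derived_set G Vl (dset G Vl)"
    unfolding dset_def by (rule theI'[OF ex1_derived_set[OF assms(1)]])
  then show steps: "(forcing_step G)\<^sup>*\<^sup>* Vl (dset G Vl)"
    unfolding is_derived_set_def by blast
  show "Vl \<subseteq> dset G Vl" "dset G Vl \<subseteq> pverts G" by (rule forcing_bounds[OF steps assms(2)])+
qed

section \<open>The controllable subspace\<close>

lemma laplacian_mat_carrier: "laplacian_mat G vs w \<in> carrier_mat (length vs) (length vs)"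
  unfolding laplacian_mat_def adjacency_mat_def by (intro minus_carrier_mat) simp

lemma input_mat_carrier: "input_mat vs ls \<in> carrier_mat (length vs) (length ls)"
  by (simp add: input_mat_def)

text \<open>For positive weights these entries are positive exactly on arcs; the diagonal, being
  nonpositive, is treated separately wherever it occurs.\<close>

lemma uminus_laplacian_off_diagonal:
  assumes "i < length vs" "j < length vs" "i \<noteq> j"
  shows "(- laplacian_mat G vs w) $$ (i, j)
    = (if (vs ! i, vs ! j) \<in> parcs G then w (vs ! i, vs ! j) else 0)"
  using assms by (simp add: laplacian_mat_def degree_mat_def adjacency_mat_def)

text \<open>Row \<open>p\<close> of the negated Laplacian sees only \<open>p\<close> and its
  out-neighbors, and an arc lowers the distance by at most one. Nothing is claimed for
  \<open>k\<close> beyond the distance, where the diagonal can produce cancellation.\<close>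

lemma laplacian_power_entry:
  fixes G :: "'a pair_pre_digraph" and w :: "'a \<times> 'a \<Rightarrow> real"
  assumes G: "pair_digraph G" and vs: "distinct vs" "set vs = pverts G"
    and w: "\<forall>e\<in>parcs G. 0 < w e" and q: "q < length vs" and p: "p < length vs"
  defines "x \<equiv> \<lambda>k. ((*\<^sub>v) (- laplacian_mat G vs w) ^^ k) (unit_vec (length vs) q)"
  shows "(enat k < graph_dist G (vs ! p) (vs ! q) \<longrightarrow> x k $ p = 0)
    \<and> (graph_dist G (vs ! p) (vs ! q) = enat k \<longrightarrow> 0 < x k $ p)"
  using p
proof (induction k arbitrary: p)
  case 0
  interpret pair_digraph G by fact
  have "vs ! p \<in> pverts G" using 0 vs by auto
  then have "graph_dist G (vs ! p) (vs ! q) = 0 \<longleftrightarrow> p = q"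
    using graph_dist_eq_0_iff[of G "vs ! p" "vs ! q"] nth_eq_iff_index_eq[OF vs(1) 0 q]
      pair_wf_digraph_axioms by blast
  then show ?case using 0 q by (auto simp: x_def zero_enat_def[symmetric])
next
  case (Suc k)
  interpret pair_digraph G by fact
  let ?n = "length vs"
  let ?A = "- laplacian_mat G vs w"
  let ?d = "\<lambda>i. graph_dist G (vs ! i) (vs ! q)"
  have A: "?A \<in> carrier_mat ?n ?n" using laplacian_mat_carrier by simp
  have C: "x k \<in> carrier_vec ?n" unfolding x_def
    by (rule vec_space.krylov_carrier[OF A]) simp
  have xS: "x (Suc k) $ p = (\<Sum>j<?n. ?A $$ (p, j) * x k $ j)"
    using Suc.prems A C by (simp add: x_def scalar_prod_def lessThan_atLeast0 sum_negf)
  have x_nonneg: "0 \<le> x k $ j" if "j < ?n" "enat k \<le> ?d j" for j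
    using Suc.IH[OF that(1)] that(2) by (metis order.strict_iff_order order.refl)
  have arc_d: "enat k \<le> ?d j" "?d p = enat (Suc k) \<or> enat k < ?d j"
    if "enat (Suc k) \<le> ?d p" "(vs ! p, vs ! j) \<in> parcs G" for j
  proof -
    have "?d p \<le> eSuc (?d j)" 
      by (rule graph_dist_arc_le[OF pair_wf_digraph_axioms that(2)])
    with that(1) show "enat k \<le> ?d j" "?d p = enat (Suc k) \<or> enat k < ?d j"
      by (cases "?d j"; cases "?d p"; auto simp: eSuc_enat)+
  qed
  have A_entry: "?A $$ (p, j) = (if (vs ! p, vs ! j) \<in> parcs G then w (vs ! p, vs ! j) else 0)"
    if "j < ?n" "j \<noteq> p" for j
    using uminus_laplacian_off_diagonal[of p vs j G w] that Suc.prems by auto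
  \<comment> \<open>This removes the diagonal summand, the only one whose coefficient can be
    negative.\<close>
  have xp: "x k $ p = 0" if "enat (Suc k) \<le> ?d p"
    using Suc.IH[OF Suc.prems] that by (meson enat_ord_simps(2) lessI less_le_trans)
  have non_arc: "?A $$ (p, j) * x k $ j = 0"
    if "enat (Suc k) \<le> ?d p" "j < ?n" "j = p \<or> (vs ! p, vs ! j) \<notin> parcs G" for j
    using that xp A_entry[of j] by (cases "j = p") simp_all
  show ?case
  proof (intro conjI impI)
    assume d: "enat (Suc k) < ?d p"
    have "?A $$ (p, j) * x k $ j = 0" if j: "j < ?n" for j
    proof (cases "j = p \<or> (vs ! p, vs ! j) \<notin> parcs G")
      case True
      then show ?thesis using non_arc[OF less_imp_le[OF d] j] by simp
    next
      case False
      then have "enat k < ?d j" using arc_d(2)[OF less_imp_le[OF d], of j] d by auto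
      then show ?thesis using Suc.IH[OF j] by simp
    qed
    then show "x (Suc k) $ p = 0" unfolding xS by (intro sum.neutral) simp
  next
    assume d: "?d p = enat (Suc k)"
    \<comment> \<open>The next node on a shortest path contributes the strictly positive summand;
      all others are nonnegative.\<close>
    obtain u where u: "(vs ! p, u) \<in> parcs G" "graph_dist G u (vs ! q) = enat k"
      using graph_dist_Suc_arc[OF pair_wf_digraph_axioms d] .
    have "u \<in> set vs" using in_arcsD2[OF u(1)] vs by simp
    then obtain i where i: "i < ?n" "u = vs ! i" by (metis in_set_conv_nth)
    have ip: "i \<noteq> p" using u i d by auto
    have "0 \<le> ?A $$ (p, j) * x k $ j" if j: "j < ?n" for j
    proof (cases "j = p \<or> (vs ! p, vs ! j) \<notin> parcs G")
      case True
      then show ?thesis using non_arc[OF eq_refl[OF d[symmetric]] j] by (metis order.refl)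
    next
      case False
      then show ?thesis
        using arc_d(1)[of j] d x_nonneg[OF j] A_entry[OF j] w by (auto intro: less_imp_le)
    qed
    moreover have "0 < ?A $$ (p, i) * x k $ i"
      using A_entry[OF i(1) ip] u i w Suc.IH[OF i(1)] by auto
    ultimately show "0 < x (Suc k) $ p"
      unfolding xS using i by (intro sum_pos2[of _ i]) auto
  qed
qed

text \<open>The weighting is arbitrary, so the bound applies in particular to one that attains the
  minimum in \<open>gamma\<close>.\<close>

lemma delta_dset_le_rank:
  fixes G :: "'a pair_pre_digraph" and w :: "'a \<times> 'a \<Rightarrow> real"
  assumes G: "pair_digraph G" and vs: "distinct vs" "set vs = pverts G"
    and Vl: "Vl \<subseteq> pverts G" and ls: "set ls = Vl"
    and w: "\<forall>e\<in>parcs G. 0 < w e"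
  shows "delta G (dset G Vl) \<le> vec_space.rank (length vs)
    (controllability_mat (length vs) (laplacian_mat G vs w) (input_mat vs ls))"
proof -
  interpret pair_digraph G by fact
  define n where "n = length vs"
  define A where "A = - laplacian_mat G vs w"
  define B where "B = input_mat vs ls"
  define \<Gamma> where "\<Gamma> = controllability_mat n (laplacian_mat G vs w) B"
  interpret vec_space "TYPE(real)" n .
  let ?x = "\<lambda>k b. ((*\<^sub>v) A ^^ k) b"
  let ?W = "set (cols \<Gamma>)"
  have L: "laplacian_mat G vs w \<in> carrier_mat n n" unfolding n_def by (rule laplacian_mat_carrier)
  have A: "A \<in> carrier_mat n n" unfolding A_def using L by simp
  have B: "B \<in> carrier_mat n (length ls)" unfolding n_def B_def by (rule input_mat_carrier)
  have W_eq: "?W = {?x k (col B j) | k j. k < n \<and> j < length ls}"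
    unfolding \<Gamma>_def A_def by (rule set_cols_controllability_mat[OF L B])
  have colB: "col B j \<in> carrier_vec n" if "j < length ls" for j using B by auto
  have W: "?W \<subseteq> carrier_vec n" unfolding W_eq using krylov_carrier[OF A] colB by auto
  \<comment> \<open>Only the exponent \<open>n - 1\<close> is critical: its successor is no longer a
    listed column, and \<open>krylov_in_span\<close> brings it back into the span.\<close>
  have inv1: "A *\<^sub>v v \<in> span ?W" if "v \<in> span ?W" for v
  proof (rule mult_mat_vec_span[OF A W W _ that])
    fix s assume "s \<in> ?W"
    then obtain k j where kj: "j < length ls" "s = ?x k (col B j)" unfolding W_eq by auto
    have "(\<lambda>k. ?x k (col B j)) ` {..<n} \<subseteq> ?W" using kj unfolding W_eq by auto
    then have "?x (Suc k) (col B j) \<in> span ?W"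
      using krylov_in_span[OF A colB[OF kj(1)]] span_is_monotone by blast
    with kj show "A *\<^sub>v s \<in> span ?W" by simp
  qed
  have inv: "?x k v \<in> span ?W" if "v \<in> span ?W" for k v
    by (induction k) (use that inv1 in auto)
  have black: "unit_vec n i \<in> span ?W"
    if "(forcing_step G)\<^sup>*\<^sup>* Vl S" "i < n" "vs ! i \<in> S" for S i
    using that
  proof (induction arbitrary: i rule: rtranclp_induct)
    case base
    then obtain j where j: "j < length ls" "vs ! i = ls ! j" using ls by (metis in_set_conv_nth)
    have "col B j = unit_vec n i"
    proof (rule eq_vecI)
      fix p assume "p < dim_vec (unit_vec n i)"
      then have p: "p < n" by simp
      then have "vs ! p = ls ! j \<longleftrightarrow> p = i"
        using nth_eq_iff_index_eq[OF vs(1), of p i] base(1) j by (simp add: n_def)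
      then show "col B j $ p = unit_vec n i $ p"
        using p j base(1) by (simp add: B_def input_mat_def n_def)
    qed (use B in auto)
    \<comment> \<open>A leader's unit vector is a column of the first block; \<open>i < n\<close>
      ensures that exponent 0 occurs.\<close>
    then have "unit_vec n i = ?x 0 (col B j)" by simp
    then have "unit_vec n i \<in> ?W"
      unfolding W_eq using j base(1) by (intro CollectI exI[of _ 0] exI[of _ j]) simp
    then show ?case using in_own_span[of ?W] W by auto
  next
    case (step S S')
    then obtain v u where v: "v \<in> S" and wh: "white_in_neighbors G S v = {u}"
      and S': "S' = insert u S"
      unfolding forcing_step_def by blast
    show ?case
    proof (cases "vs ! i \<in> S")
      case True
      with step show ?thesis by blast
    next
      case False
      with S' step.prems have u: "u = vs ! i" by simp
      have "S \<subseteq> pverts G" by (rule forcing_bounds(2)[OF step.hyps(1) Vl])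
      then obtain j where j: "j < n" "v = vs ! j"
        using v vs by (metis in_set_conv_nth n_def subsetD)
      have ij: "i \<noteq> j" using False v j by auto
      have arc: "(u, v) \<in> parcs G" using wh unfolding white_in_neighbors_def by auto
      \<comment> \<open>Column \<open>j\<close> without its entry at the forced node
        \<open>u\<close>. Its remaining support consists of \<open>v\<close> itself and in-neighbors
        of \<open>v\<close> other than \<open>u\<close>, all of them black.\<close>
      define y where "y = col A j - A $$ (i, j) \<cdot>\<^sub>v unit_vec n i"
      have "col A j = A *\<^sub>v unit_vec n j" 
        using A j by (intro eq_vecI) (auto simp: scalar_prod_right_unit[of _ n])
      then have Aj: "col A j \<in> span ?W" using inv1 step.IH[OF j(1)] v j by auto
      have y: "y \<in> carrier_vec n" using A unfolding y_def by auto
      have "y \<in> span ?W"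
      proof (rule supported_in_span[OF W y])
        fix p assume p: "p < n" "y $ p \<noteq> 0"
        have pi: "p \<noteq> i" using p A j unfolding y_def by auto
        then have Ap: "A $$ (p, j) \<noteq> 0" using p A j step.prems(1) unfolding y_def by auto
        have "vs ! p \<in> S"
        proof (cases "p = j")
          case True
          with v j show ?thesis by simp
        next
          case False
          then have "(vs ! p, v) \<in> parcs G"
            using Ap uminus_laplacian_off_diagonal[of p vs j G w] p j
            by (auto simp: A_def n_def split: if_splits)
          moreover have "vs ! p \<noteq> u"
            using pi u p step.prems(1) vs by (auto simp: nth_eq_iff_index_eq n_def)
          moreover have "vs ! p \<in> pverts G" using p vs by (auto simp: n_def)
          ultimately show ?thesis using wh unfolding white_in_neighbors_def by blast
        qed
        then show "unit_vec n p \<in> span ?W" using step.IH p by blast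
      qed
      \<comment> \<open>Subtracting \<open>y\<close> leaves the unit vector of \<open>u\<close>
        scaled by the weight of the arc from \<open>u\<close> to \<open>v\<close>, which can be
        divided out.\<close>
      then have "(-1) \<cdot>\<^sub>v y \<in> span ?W" by (rule smult_in_span[OF W])
      with Aj have "col A j + (-1) \<cdot>\<^sub>v y \<in> span ?W" using span_add1[of ?W] W by simp
      then have "inverse (A $$ (i, j)) \<cdot>\<^sub>v (col A j + (-1) \<cdot>\<^sub>v y) \<in> span ?W"
        by (rule smult_in_span[OF W])
      moreover have "A $$ (i, j) \<noteq> 0"
        using uminus_laplacian_off_diagonal[of i vs j G w] ij j step.prems(1) arc u w
        by (auto simp: A_def n_def)
      then have "inverse (A $$ (i, j)) \<cdot>\<^sub>v (col A j + (-1) \<cdot>\<^sub>v y) = unit_vec n i"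
        using A j step.prems(1) unfolding y_def by (intro eq_vecI) auto
      ultimately show ?thesis by simp
    qed
  qed

  \<comment> \<open>Independent vectors from a PMI sequence\<close>
  let ?D = "dset G Vl"
  have fin: "finite (pverts G)" by simp
  note D = derived_set_bounds[OF fin Vl]
  obtain Ds where Ds: "set Ds \<subseteq> admissible_dl_vectors G ?D" "pmi ?D Ds" "length Ds = delta G ?D"
    using delta_witness[OF fin] .
  have "\<exists>p q k. p < n \<and> q < n \<and> vs ! q \<in> ?D \<and> graph_dist G (vs ! p) (vs ! q) = enat k
      \<and> Ds ! i = dl_vector G ?D (vs ! p)
      \<and> (\<forall>j. i < j \<and> j < length Ds \<longrightarrow> enat k < (Ds ! j) (vs ! q))" if i: "i < length Ds" for i
  proof -
    have "Ds ! i \<in> admissible_dl_vectors G ?D" using Ds(1) i by auto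
    then obtain v l0 where v: "v \<in> pverts G" "Ds ! i = dl_vector G ?D v"
      and l0: "l0 \<in> ?D" "(Ds ! i) l0 \<noteq> \<infinity>"
      unfolding admissible_dl_vectors_def by blast
    obtain l1 where l1: "l1 \<in> ?D" "\<forall>j. i < j \<and> j < length Ds \<longrightarrow> (Ds ! i) l1 < (Ds ! j) l1"
      using Ds(2) i unfolding pmi_def by blast
    \<comment> \<open>A PMI coordinate of the last vector may be infinite, so a finite entry is
      taken there; elsewhere, lying strictly below a later entry forces finiteness.\<close>
    obtain l where l: "l \<in> ?D" "(Ds ! i) l \<noteq> \<infinity>"
      "\<forall>j. i < j \<and> j < length Ds \<longrightarrow> (Ds ! i) l < (Ds ! j) l"
    proof (cases "Suc i < length Ds")
      case True
      then have "(Ds ! i) l1 < (Ds ! Suc i) l1" using l1(2) by blast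
      then have "(Ds ! i) l1 \<noteq> \<infinity>" by (cases "(Ds ! i) l1") auto
      with l1 that show ?thesis by blast
    next
      case False
      then have "\<forall>j. i < j \<and> j < length Ds \<longrightarrow> (Ds ! i) l0 < (Ds ! j) l0" by auto
      with l0 that show ?thesis by blast
    qed
    obtain p where p: "p < n" "vs ! p = v" using v vs by (metis in_set_conv_nth n_def)
    obtain q where q: "q < n" "vs ! q = l" using l D(3) vs by (metis in_set_conv_nth n_def subsetD)
    have "(Ds ! i) l = graph_dist G v l" using v l by (simp add: dl_vector_def)
    with l p q v show ?thesis by (metis not_infinity_eq)
  qed
  then obtain p q k where pqk: "\<And>i. i < length Ds \<Longrightarrow> p i < n \<and> q i < n \<and> vs ! q i \<in> ?D
      \<and> graph_dist G (vs ! p i) (vs ! q i) = enat (k i)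
      \<and> Ds ! i = dl_vector G ?D (vs ! p i)
      \<and> (\<forall>j. i < j \<and> j < length Ds \<longrightarrow> enat (k i) < (Ds ! j) (vs ! q i))"
    by metis
  \<comment> \<open>The exponent is the distance from node \<open>p i\<close> to leader
    \<open>q i\<close>, so \<open>c i\<close> is positive at \<open>p i\<close> but still zero at
    every later \<open>p j\<close>, which is farther from that leader.\<close>
  define c where "c i = ?x (k i) (unit_vec n (q i))" for i
  have entry: "(enat (k i) < graph_dist G (vs ! p j) (vs ! q i) \<longrightarrow> c i $ p j = 0)
    \<and> (graph_dist G (vs ! p j) (vs ! q i) = enat (k i) \<longrightarrow> 0 < c i $ p j)"
    if "i < length Ds" "j < length Ds" for i j
    using laplacian_power_entry[OF G vs w, of "q i" "p j" "k i"] pqk that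
    by (simp add: c_def A_def n_def)
  let ?cs = "map c [0..<length Ds]"
  have c_carrier: "c i \<in> carrier_vec n" for i unfolding c_def by (rule krylov_carrier[OF A]) simp
  have "length ?cs \<le> vectorspace.dim class_ring (span_vs ?W)"
  proof (rule chain_length_le_dim_span[OF W])
    show "set ?cs \<subseteq> span ?W" using inv black[OF D(1)] pqk by (auto simp: c_def)
  next
    fix i assume i: "i < length ?cs"
    have T: "set (take i ?cs) = c ` {..<i}" using i by (auto simp: take_map)
    \<comment> \<open>Triangularity: all earlier vectors vanish at \<open>p i\<close>, whereas
      \<open>c i\<close> does not.\<close>
    have "s $ p i = 0" if s: "s \<in> c ` {..<i}" for s
    proof -
      obtain j where j: "j < i" "s = c j" using s by auto
      with pqk[of j] i have "enat (k j) < (Ds ! i) (vs ! q j)" by auto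
      also have "\<dots> = graph_dist G (vs ! p i) (vs ! q j)"
        using pqk[of i] pqk[of j] i j by (simp add: dl_vector_def)
      finally show ?thesis using entry[of j i] i j by simp
    qed
    then have "v $ p i = 0" if "v \<in> span (c ` {..<i})" for v
      using span_entry_zero[of "c ` {..<i}" "p i" v] that c_carrier pqk[of i] i by auto
    moreover have "0 < c i $ p i" using entry[of i i] pqk[of i] i by simp
    ultimately show "?cs ! i \<notin> span (set (take i ?cs))" unfolding T using i by fastforce
  qed simp
  then have "length ?cs \<le> rank \<Gamma>" unfolding rank_def .
  then show ?thesis using Ds(3) unfolding \<Gamma>_def B_def n_def by simp
qed

theorem theorem4p2:
  fixes G :: "'a pair_pre_digraph" and Vl :: "'a set" and vs ls :: "'a list"
  assumes "pair_digraph G"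
    and "distinct vs" and "set vs = pverts G"
    and "Vl \<subseteq> pverts G"
    and "distinct ls" and "set ls = Vl"
  shows "delta G Vl \<le> delta G (dset G Vl)
    \<and> zeta G Vl \<le> delta G (dset G Vl)
    \<and> delta G (dset G Vl) \<le> gamma G vs ls"
proof (intro conjI)
  interpret pair_digraph G by fact
  have fin: "finite (pverts G)" by simp
  note D = derived_set_bounds[OF fin assms(4)]
  show "delta G Vl \<le> delta G (dset G Vl)" by (rule delta_mono[OF fin D(2)])
  show "zeta G Vl \<le> delta G (dset G Vl)"
    unfolding zeta_def by (rule card_leaders_le_delta[OF pair_wf_digraph_axioms fin D(3)])
  \<comment> \<open>Constant weight 1 shows that some rank occurs, so the \<open>LEAST\<close> is
    attained by a weighting.\<close>
  have "\<exists>r. \<exists>w :: 'a \<times> 'a \<Rightarrow> real. (\<forall>e \<in> parcs G. 0 < w e) \<and> r = vec_space.rank (length vs)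
      (controllability_mat (length vs) (laplacian_mat G vs w) (input_mat vs ls))"
    by (rule exI, rule exI[of _ "\<lambda>_. 1"]) simp
  from LeastI_ex[OF this] obtain w :: "'a \<times> 'a \<Rightarrow> real" where "\<forall>e \<in> parcs G. 0 < w e"
    and "gamma G vs ls = vec_space.rank (length vs)
      (controllability_mat (length vs) (laplacian_mat G vs w) (input_mat vs ls))"
    unfolding gamma_def by blast
  with delta_dset_le_rank[OF assms(1-4,6)] show "delta G (dset G Vl) \<le> gamma G vs ls" by simp
qed

end
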